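(* Let $f\in\mathcal{S}^{*}_{e}$ with $f(z)=z+a_2z^2+a_3z^3+\cdots$. Then $$|H_3(1)|\le \frac{1}{9},$$ where $H_3(1)=2a_2a_3a_4-a_3^3-a_4^2-a_2^2a_5+a_3a_5$. This bound is sharp, i.e. there is a function in $\mathcal{S}^{*}_{e}$ for which equality holds.
   Context: Let $\mathbb{D}=\{z\in\mathbb{C}:|z|<1\}$ and let $\mathcal{A}$ be the set of analytic functions $f$ on $\mathbb{D}$ of the form $f(z)=z+a_2z^2+a_3z^3+\cdots$. For functions $h_1,h_2$ analytic on $\mathbb{D}$, $h_1\prec h_2$ ($h_1$ is subordinate to $h_2$) means that there is a Schwarz function $w$, i.e. an analytic $w$ on $\mathbb{D}$ with $w(0)=0$ and $|w(z)|\le|z|$, such that $h_1(z)=h_2(w(z))$ on $\mathbb{D}$. The class $\mathcal{S}^{*}_{e}$ is $$\mathcal{S}^{*}_{e}=\left\{f\in\mathcal{A}:\frac{zf'(z)}{f(z)}\prec e^{z}\right\}.$$ For $f\in\mathcal{A}$ with $a_1=1$, the Hankel determinant $H_q(n)$ is the determinant of the $q\times q$ matrix whose $(i,j)$ entry is $a_{n+i+j-2}$, $1\le i,j\le q$; for $q=3$, $n=1$ it equals the expression given for $H_3(1)$. *)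

theory Defs
  imports "HOL-Complex_Analysis.Complex_Analysis" "Jordan_Normal_Form.Determinant"
begin

abbreviation unit_disk :: "complex set" where
  "unit_disk \<equiv> ball 0 1"

definition taylor_coeff :: "(complex \<Rightarrow> complex) \<Rightarrow> nat \<Rightarrow> complex" where
  "taylor_coeff f n = fps_nth (fps_expansion f 0) n"

definition class_A :: "(complex \<Rightarrow> complex) set" where
  "class_A = {f. f holomorphic_on unit_disk \<and> taylor_coeff f 0 = 0 \<and> taylor_coeff f 1 = 1}"

definition schwarz_function :: "(complex \<Rightarrow> complex) \<Rightarrow> bool" where
  "schwarz_function w \<longleftrightarrow>
     w holomorphic_on unit_disk \<and> w 0 = 0 \<and> (\<forall>z\<in>unit_disk. norm (w z) \<le> norm z)"

definition subordinate :: "(complex \<Rightarrow> complex) \<Rightarrow> (complex \<Rightarrow> complex) \<Rightarrow> bool" where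
  "subordinate h1 h2 \<longleftrightarrow>
     h1 holomorphic_on unit_disk \<and> h2 holomorphic_on unit_disk \<and>
     (\<exists>w. schwarz_function w \<and> (\<forall>z\<in>unit_disk. h1 z = h2 (w z)))"

text \<open>The quotient \<open>z f'(z) / f(z)\<close> of \<open>f \<in> class_A\<close> has a removable singularity at the
  origin, with value \<open>1\<close>. Since \<open>x / 0 = 0\<close> in HOL, that value is set explicitly. No such care is
  needed elsewhere: at a zero \<open>z \<noteq> 0\<close> of \<open>f\<close> the HOL quotient is \<open>0\<close>, a value \<open>exp\<close> never takes,
  so subordination to \<open>exp\<close> forces \<open>f\<close> to vanish only at the origin.\<close>

definition starlike_quotient :: "(complex \<Rightarrow> complex) \<Rightarrow> complex \<Rightarrow> complex" where
  "starlike_quotient f z = (if z = 0 then 1 else z * deriv f z / f z)"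

definition class_S_star_e :: "(complex \<Rightarrow> complex) set" where
  "class_S_star_e = {f \<in> class_A. subordinate (starlike_quotient f) exp}"

text \<open>Matrix indices start at \<open>0\<close> here, so the usual entry \<open>a (n + i + j - 2)\<close>,
  \<open>1 \<le> i, j \<le> q\<close>, becomes \<open>a (n + i + j)\<close>, \<open>i, j < q\<close>.\<close>

definition hankel_det :: "(nat \<Rightarrow> complex) \<Rightarrow> nat \<Rightarrow> nat \<Rightarrow> complex" where
  "hankel_det a q n = Determinant.det (Matrix.mat q q (\<lambda>(i, j). a (n + i + j)))"

lemma starlike_quotient_tendsto:
  assumes "f \<in> class_A"
  shows "((\<lambda>z. z * deriv f z / f z) \<longlongrightarrow> starlike_quotient f 0) (at 0)"
proof -
  have hol: "f holomorphic_on unit_disk" and f0: "f 0 = 0" and d0: "deriv f 0 = 1"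
    using assms by (auto simp: class_A_def taylor_coeff_def fps_expansion_def)
  have "(f has_field_derivative 1) (at 0)"
    using holomorphic_derivI[OF hol, of 0] d0 by simp
  then have q: "((\<lambda>z. f z / z) \<longlongrightarrow> 1) (at 0)"
    by (simp add: has_field_derivative_iff f0)
  have "continuous_on unit_disk (deriv f)"
    using hol by (intro holomorphic_on_imp_continuous_on holomorphic_deriv) auto
  then have "(deriv f \<longlongrightarrow> 1) (at 0)"
    using d0 by (simp add: continuous_on_eq_continuous_at isCont_def)
       (drule bspec[of _ _ 0], simp_all)
  then have "((\<lambda>z. deriv f z / (f z / z)) \<longlongrightarrow> 1 / 1) (at 0)"
    using q by (intro tendsto_divide) auto
  then show ?thesis
    by (simp add: starlike_quotient_def mult.commute)
qed

lemma hankel_det_3_1: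
  assumes "a 1 = 1"
  shows "hankel_det a 3 1 =
    2 * a 2 * a 3 * a 4 - a 3 ^ 3 - a 4 ^ 2 - a 2 ^ 2 * a 5 + a 3 * a 5"
proof -
  let ?A = "Matrix.mat 3 3 (\<lambda>(i, j). a (1 + i + j))"
  have det2: "Determinant.det (Matrix.mat 2 2 g) = g (0, 0) * g (1, 1) - g (0, 1) * g (1, 0)"
    for g :: "nat \<times> nat \<Rightarrow> complex"
    by (subst laplace_expansion_row[of _ 2 0])
       (auto simp: numeral_2_eq_2 cofactor_def mat_delete_def det_single)
  have "hankel_det a 3 1 = (\<Sum>j<3. ?A $$ (0, j) * cofactor ?A 0 j)"
    unfolding hankel_det_def by (rule laplace_expansion_row) auto
  also have "\<dots> = (\<Sum>j<3. ?A $$ (0, j) * ((-1) ^ j *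
      Determinant.det (Matrix.mat 2 2 (\<lambda>(i', j'). ?A $$ (Suc i', if j' < j then j' else Suc j')))))"
    by (simp add: cofactor_def mat_delete_def)
  also have "\<dots> = 2 * a 2 * a 3 * a 4 - a 3 ^ 3 - a 4 ^ 2 - a 2 ^ 2 * a 5 + a 3 * a 5"
    unfolding det2 using assms
    by (simp add: eval_nat_numeral algebra_simps)
  finally show ?thesis .
qed

end

theory Submission
  imports Defs
begin

text \<open>
  Let \<open>z f'/f = exp w\<close> with a Schwarz function \<open>w = p z + A z\<^sup>2 + B z\<^sup>3 + D z\<^sup>4 + \<dots>\<close>. Comparing
  coefficients in \<open>z f' = exp(w) f\<close> makes the Hankel determinant a polynomial in these four
  coefficients (lemma \<open>hankel_starlike_exp\<close>). Its dominant term is \<open>- B\<^sup>2 / 9\<close>. For \<open>w = z\<^sup>3\<close> nothing else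
  is left, so the value \<open>1/9\<close> is attained (lemma \<open>starlike_exp_hankel_sharp\<close>).

  For the upper bound, bounds on the single coefficients are too weak: already for \<open>p = 0\<close>,
  \<open>\<bar>B\<bar> \<le> 1 - \<bar>A\<bar>\<^sup>2\<close> and \<open>\<bar>D\<bar> \<le> 1 - \<bar>A\<bar>\<^sup>2\<close> alone do not give \<open>1/9\<close>, and it matters that a large \<open>B\<close>
  and a small \<open>A\<close> force \<open>D\<close> to be small. The exact range of the coefficients is given by Schur's algorithm (lemma
  \<open>schur_parameters\<close>): they are expressed by independent parameters \<open>p\<close>, \<open>x\<close>, \<open>y\<close> of the closed disk and
  a fourth parameter \<open>v\<close> with \<open>\<bar>v\<bar> \<le> 1 - \<bar>y\<bar>\<^sup>2\<close>. In these parameters the terms of the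
  determinant can be grouped (lemma \<open>hankel_schur_form\<close>) so that the triangle inequality loses
  nothing at the extremal point \<open>p = x = 0\<close>, \<open>\<bar>y\<bar> = 1\<close>. It leaves a polynomial inequality in \<open>\<bar>p\<bar>\<close> and
  \<open>\<bar>x\<bar>\<close> alone (lemma \<open>hankel_real_bound\<close>).
\<close>

section \<open>Taylor series of functions on the unit disk\<close>

lemma analytic_disk_fps:
  assumes "f holomorphic_on unit_disk"
  shows "f has_fps_expansion fps_expansion f 0"
  using assms by (intro has_fps_expansion_fps_expansion[of unit_disk]) auto

lemma fps_eq_if_eq_on_disk:
  fixes f g :: "complex \<Rightarrow> complex"
  assumes "f has_fps_expansion F" "g has_fps_expansion G"
    and "\<And>z. z \<in> unit_disk \<Longrightarrow> f z = g z"
  shows "F = G"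
proof -
  have "eventually (\<lambda>z. z \<in> unit_disk) (nhds (0::complex))"
    by (intro eventually_nhds_in_open) auto
  then have "eventually (\<lambda>z. f z = g z) (nhds 0)"
    by eventually_elim (use assms(3) in auto)
  then have "g has_fps_expansion F"
    using assms(1) has_fps_expansion_cong[of f g F F] by simp
  then show ?thesis
    using assms(2) fps_expansion_unique_complex by blast
qed

lemma taylor_coeff_0: "taylor_coeff f 0 = f 0"
  by (simp add: taylor_coeff_def fps_expansion_def)

section \<open>Schur's algorithm\<close>

definition schur_function :: "(complex \<Rightarrow> complex) \<Rightarrow> bool" where
  "schur_function g \<longleftrightarrow> g holomorphic_on unit_disk \<and> (\<forall>z\<in>unit_disk. norm (g z) \<le> 1)"

text \<open>The singularity of \<open>w(z)/z\<close> at the origin is removable with value \<open>w'(0)\<close>, which the Schwarz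
  lemma bounds by \<open>1\<close>.\<close>

lemma schwarz_function_factor:
  assumes "schwarz_function w"
  obtains g where "schur_function g" "\<And>z. z \<in> unit_disk \<Longrightarrow> w z = z * g z"
proof -
  have hol: "w holomorphic_on ball 0 1" and w0: "w 0 = 0"
    and le: "\<And>z. z \<in> unit_disk \<Longrightarrow> norm (w z) \<le> norm z"
    using assms by (auto simp: schwarz_function_def)
  have lt: "norm (w z) < 1" if "norm z < 1" for z
    using le[of z] that by auto
  obtain g where g: "g holomorphic_on ball 0 1" "\<And>z. norm z < 1 \<Longrightarrow> w z = z * g z"
    "deriv w 0 = g 0"
    using Schwarz3[OF hol w0] by blast
  have "norm (g z) \<le> 1" if z: "z \<in> unit_disk" for z
  proof (cases "z = 0")
    case True
    then show ?thesis
      using Schwarz_Lemma(2)[OF hol w0 lt, of 0] g(3) by simp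
  next
    case False
    have "norm z * norm (g z) \<le> norm z * 1"
      using le[OF z] g(2)[of z] z by (simp add: norm_mult)
    then show ?thesis
      using False by simp
  qed
  then show thesis
    using that[of g] g by (auto simp: schur_function_def)
qed

lemma schur_function_strict_or_constant:
  assumes g: "schur_function g"
  shows "(\<forall>z\<in>unit_disk. norm (g z) < 1) \<or> (\<forall>z\<in>unit_disk. g z = g 0)"
proof (cases "\<forall>z\<in>unit_disk. norm (g z) < 1")
  case False
  then obtain \<xi> where \<xi>: "\<xi> \<in> unit_disk" "norm (g \<xi>) = 1"
    using g by (force simp: schur_function_def)
  have "g constant_on unit_disk"
    by (rule maximum_modulus_principle[of g unit_disk unit_disk \<xi>])
       (use g \<xi> in \<open>auto simp: schur_function_def\<close>)
  then obtain c where c: "\<forall>z\<in>unit_disk. g z = c"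
    unfolding constant_on_def by blast
  then have "g 0 = c"
    by (rule bspec) simp
  with c show ?thesis
    by blast
qed auto

text \<open>One step of the algorithm. The disk automorphism that sends \<open>g 0\<close> to \<open>0\<close> turns \<open>g\<close> into a Schwarz
  function, hence into \<open>z \<phi>(z)\<close>; solving for \<open>g\<close> and clearing the denominator gives the equation.
  In this form it also holds, with \<open>\<phi> = 0\<close>, for a constant \<open>g\<close> of modulus \<open>1\<close>, where that automorphism
  does not exist. The algorithm may therefore be iterated without case distinctions.\<close>

lemma schur_step:
  assumes g: "schur_function g"
  obtains \<phi> where "schur_function \<phi>"
    "\<And>z. z \<in> unit_disk \<Longrightarrow> g z = g 0 + z * \<phi> z * (1 - cnj (g 0) * g z)"
proof (cases "\<forall>z\<in>unit_disk. norm (g z) < 1")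
  case True
  have g0: "norm (g 0) < 1"
    using True by simp
  define h where "h = Moebius_function 0 (g 0) \<circ> g"
  have "h holomorphic_on unit_disk"
    unfolding h_def
    by (rule holomorphic_on_compose_gen[OF _ Moebius_function_holomorphic[OF g0]])
       (use g True in \<open>auto simp: schur_function_def\<close>)
  moreover have h0: "h 0 = 0"
    by (simp add: h_def Moebius_function_eq_zero)
  moreover have h1: "norm (h z) < 1" if "norm z < 1" for z
    unfolding h_def o_def by (rule Moebius_function_norm_lt_1) (use g0 True that in auto)
  ultimately have "schwarz_function h"
    using Schwarz_Lemma(1)[of h] by (auto simp: schwarz_function_def)
  then obtain \<phi> where \<phi>: "schur_function \<phi>" "\<And>z. z \<in> unit_disk \<Longrightarrow> h z = z * \<phi> z"
    using schwarz_function_factor by blast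
  have "g z = g 0 + z * \<phi> z * (1 - cnj (g 0) * g z)" if z: "z \<in> unit_disk" for z
  proof -
    have "norm (cnj (g 0) * g z) < 1"
      using norm_mult_less[of "cnj (g 0)" 1 "g z" 1] g0 True z by auto
    then have "1 - cnj (g 0) * g z \<noteq> 0"
      by auto
    then show ?thesis
      using \<phi>(2)[OF z, symmetric] by (simp add: h_def Moebius_function_simple)
  qed
  then show thesis
    using that \<phi>(1) by blast
next
  case False
  then have const: "g z = g 0" if "z \<in> unit_disk" for z
    using schur_function_strict_or_constant[OF g] that by blast
  show thesis
  proof (rule that)
    show "schur_function (\<lambda>_. 0)"
      by (simp add: schur_function_def)
    show "g z = g 0 + z * 0 * (1 - cnj (g 0) * g z)" if "z \<in> unit_disk" for z
      unfolding mult_zero_right mult_zero_left add_0_right using that by (rule const)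
  qed
qed

lemma schur_step_coeffs:
  assumes g: "schur_function g"
  obtains \<phi> where "schur_function \<phi>"
    "\<And>n. taylor_coeff g (Suc n) = taylor_coeff \<phi> n
       - cnj (g 0) * (\<Sum>i=0..n. taylor_coeff \<phi> i * taylor_coeff g (n - i))"
proof -
  obtain \<phi> where \<phi>: "schur_function \<phi>"
    "\<And>z. z \<in> unit_disk \<Longrightarrow> g z = g 0 + z * \<phi> z * (1 - cnj (g 0) * g z)"
    using schur_step[OF g] by blast
  define G where "G = fps_expansion g 0"
  define \<Phi> where "\<Phi> = fps_expansion \<phi> 0"
  have exps: "g has_fps_expansion G" "\<phi> has_fps_expansion \<Phi>"
    using g \<phi>(1) by (auto simp: G_def \<Phi>_def schur_function_def intro: analytic_disk_fps)
  have "(\<lambda>z. g 0 + z * \<phi> z * (1 - cnj (g 0) * g z)) has_fps_expansion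
      fps_const (g 0) + fps_X * \<Phi> * (1 - fps_const (cnj (g 0)) * G)"
    by (intro fps_expansion_intros exps)
  then have "G = fps_const (g 0) + fps_X * \<Phi> * (1 - fps_const (cnj (g 0)) * G)"
    using fps_eq_if_eq_on_disk[OF exps(1)] \<phi>(2) by blast
  also have "\<dots> = fps_const (g 0) + fps_X * (\<Phi> - fps_const (cnj (g 0)) * (\<Phi> * G))"
    by (simp add: algebra_simps)
  finally have "fps_nth G (Suc n) =
      fps_nth (fps_const (g 0) + fps_X * (\<Phi> - fps_const (cnj (g 0)) * (\<Phi> * G))) (Suc n)" for n
    by (rule arg_cong)
  then have "fps_nth G (Suc n) = fps_nth \<Phi> n - cnj (g 0) * fps_nth (\<Phi> * G) n" for n
    by simp
  then show thesis
    using that[OF \<phi>(1)] by (simp add: G_def \<Phi>_def taylor_coeff_def fps_mult_nth)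
qed

lemma norm_one_minus_mult_cnj:
  fixes z :: complex
  assumes "norm z \<le> 1"
  shows "norm (1 - z * cnj z) = 1 - (norm z)\<^sup>2"
proof -
  have "norm (1 - z * cnj z) = norm (complex_of_real (1 - (norm z)\<^sup>2))"
    by (simp only: of_real_diff of_real_1 complex_norm_square)
  also have "\<dots> = 1 - (norm z)\<^sup>2"
    using power_le_one[OF norm_ge_zero assms, of 2]
    by (simp only: norm_of_real abs_of_nonneg diff_ge_0_iff_ge)
  finally show ?thesis .
qed

text \<open>Three steps of the algorithm. The numbers \<open>p\<close>, \<open>x\<close>, \<open>y\<close> are the values at \<open>0\<close> of \<open>g\<close> and of its
  first two iterates, and \<open>\<phi>1\<close>, \<open>\<phi>2\<close> are the next coefficients of the first iterate. The value \<open>u\<close> at \<open>0\<close>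
  of the third iterate enters only through the product \<open>v = (1 - \<bar>y\<bar>\<^sup>2) u\<close>.\<close>

lemma schur_parameters:
  assumes g: "schur_function g" and p: "p = taylor_coeff g 0"
  obtains x y v \<phi>1 \<phi>2 :: complex
  where "norm x \<le> 1" "norm y \<le> 1" "norm v \<le> 1 - (norm y)\<^sup>2"
    and "\<phi>1 = (1 - x * cnj x) * y" "\<phi>2 = (1 - x * cnj x) * (v - cnj x * y\<^sup>2)"
    and "taylor_coeff g 1 = (1 - p * cnj p) * x"
    and "taylor_coeff g 2 = (1 - p * cnj p) * (\<phi>1 - cnj p * x\<^sup>2)"
    and "taylor_coeff g 3 = (1 - p * cnj p) * (\<phi>2 - 2 * cnj p * x * \<phi>1 + (cnj p)\<^sup>2 * x ^ 3)"
proof -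
  have at_0: "norm (h 0) \<le> 1" if "schur_function h" for h
    using that by (simp add: schur_function_def)
  obtain \<phi> where \<phi>: "schur_function \<phi>"
    "\<And>n. taylor_coeff g (Suc n) = taylor_coeff \<phi> n
       - cnj (g 0) * (\<Sum>i=0..n. taylor_coeff \<phi> i * taylor_coeff g (n - i))"
    using schur_step_coeffs[OF g] by blast
  obtain \<psi> where \<psi>: "schur_function \<psi>"
    "\<And>n. taylor_coeff \<phi> (Suc n) = taylor_coeff \<psi> n
       - cnj (\<phi> 0) * (\<Sum>i=0..n. taylor_coeff \<psi> i * taylor_coeff \<phi> (n - i))"
    using schur_step_coeffs[OF \<phi>(1)] by blast
  obtain \<eta> where \<eta>: "schur_function \<eta>"
    "\<And>n. taylor_coeff \<psi> (Suc n) = taylor_coeff \<eta> n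
       - cnj (\<psi> 0) * (\<Sum>i=0..n. taylor_coeff \<eta> i * taylor_coeff \<psi> (n - i))"
    using schur_step_coeffs[OF \<psi>(1)] by blast
  define x y v where "x = \<phi> 0" and "y = \<psi> 0" and "v = (1 - y * cnj y) * \<eta> 0"
  have p_eq: "g 0 = p"
    using p by (simp add: taylor_coeff_0)
  have "norm y \<le> 1" and "norm x \<le> 1"
    using at_0 \<phi>(1) \<psi>(1) by (simp_all add: x_def y_def)
  have v: "norm v \<le> 1 - (norm y)\<^sup>2"
  proof -
    have "norm v = (1 - (norm y)\<^sup>2) * norm (\<eta> 0)"
      using norm_one_minus_mult_cnj[OF \<open>norm y \<le> 1\<close>] by (simp add: v_def norm_mult)
    also have "\<dots> \<le> 1 - (norm y)\<^sup>2"
      using at_0[OF \<eta>(1)] \<open>norm y \<le> 1\<close> by (intro mult_left_le) (auto simp: power_le_one)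
    finally show ?thesis .
  qed
  have step1: "taylor_coeff h (Suc 0) = (1 - h 0 * cnj (h 0)) * taylor_coeff k 0"
    if "\<And>n. taylor_coeff h (Suc n) = taylor_coeff k n
       - cnj (h 0) * (\<Sum>i=0..n. taylor_coeff k i * taylor_coeff h (n - i))" for h k
    using that[of 0] by (simp add: taylor_coeff_0 algebra_simps)
  have step2: "taylor_coeff h (Suc (Suc 0)) =
      (1 - h 0 * cnj (h 0)) * (taylor_coeff k (Suc 0) - cnj (h 0) * (taylor_coeff k 0)\<^sup>2)"
    if "\<And>n. taylor_coeff h (Suc n) = taylor_coeff k n
       - cnj (h 0) * (\<Sum>i=0..n. taylor_coeff k i * taylor_coeff h (n - i))" for h k
    using that[of "Suc 0"] step1[OF that]
    by (simp add: taylor_coeff_0) (simp add: algebra_simps power2_eq_square)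
  have \<phi>1: "taylor_coeff \<phi> (Suc 0) = (1 - x * cnj x) * y"
    using step1[OF \<psi>(2)] by (simp add: taylor_coeff_0 x_def y_def)
  have \<phi>2: "taylor_coeff \<phi> (Suc (Suc 0)) = (1 - x * cnj x) * (v - cnj x * y\<^sup>2)"
    using step2[OF \<psi>(2)] step1[OF \<eta>(2)] by (simp add: taylor_coeff_0 x_def y_def v_def)
  have g1: "taylor_coeff g (Suc 0) = (1 - p * cnj p) * x"
    using step1[OF \<phi>(2)] by (simp add: taylor_coeff_0 x_def p_eq)
  have g2: "taylor_coeff g (Suc (Suc 0)) = (1 - p * cnj p) * (taylor_coeff \<phi> (Suc 0) - cnj p * x\<^sup>2)"
    using step2[OF \<phi>(2)] by (simp add: taylor_coeff_0 x_def p_eq)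
  have "taylor_coeff g (Suc (Suc (Suc 0))) = taylor_coeff \<phi> (Suc (Suc 0))
      - cnj p * (x * taylor_coeff g (Suc (Suc 0)) + taylor_coeff \<phi> (Suc 0) * taylor_coeff g (Suc 0)
        + taylor_coeff \<phi> (Suc (Suc 0)) * p)"
    using \<phi>(2)[of "Suc (Suc 0)"] by (simp add: taylor_coeff_0 p_eq x_def)
  also have "\<dots> = (1 - p * cnj p) * (taylor_coeff \<phi> (Suc (Suc 0))
      - 2 * cnj p * x * taylor_coeff \<phi> (Suc 0) + (cnj p)\<^sup>2 * x ^ 3)"
    unfolding g1 g2 by (simp add: algebra_simps power2_eq_square power3_eq_cube)
  finally have g3: "taylor_coeff g (Suc (Suc (Suc 0))) = (1 - p * cnj p) * (taylor_coeff \<phi> (Suc (Suc 0))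
      - 2 * cnj p * x * taylor_coeff \<phi> (Suc 0) + (cnj p)\<^sup>2 * x ^ 3)" .
  have c1: "taylor_coeff g 1 = (1 - p * cnj p) * x"
    using g1 unfolding One_nat_def .
  have c2: "taylor_coeff g 2 = (1 - p * cnj p) * (taylor_coeff \<phi> (Suc 0) - cnj p * x\<^sup>2)"
    using g2 unfolding numeral_2_eq_2 .
  have c3: "taylor_coeff g 3 = (1 - p * cnj p) * (taylor_coeff \<phi> (Suc (Suc 0))
      - 2 * cnj p * x * taylor_coeff \<phi> (Suc 0) + (cnj p)\<^sup>2 * x ^ 3)"
    using g3 unfolding numeral_3_eq_3 .
  show thesis
    by (rule that[OF \<open>norm x \<le> 1\<close> \<open>norm y \<le> 1\<close> v \<phi>1 \<phi>2 c1 c2 c3])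
qed

section \<open>The Hankel determinant in terms of the Schwarz function\<close>

text \<open>A zero \<open>z \<noteq> 0\<close> of \<open>f\<close> is excluded because the quotient would then be \<open>0\<close>, which is not a value
  of \<open>exp\<close>.\<close>

lemma starlike_exp_relation:
  assumes f: "f \<in> class_A" and q: "\<And>z. z \<in> unit_disk \<Longrightarrow> starlike_quotient f z = exp (w z)"
    and z: "z \<in> unit_disk"
  shows "z * deriv f z = exp (w z) * f z"
proof (cases "z = 0")
  case True
  then show ?thesis
    using f by (simp add: class_A_def taylor_coeff_0)
next
  case False
  then have "z * deriv f z / f z = exp (w z)"
    using q[OF z] by (simp add: starlike_quotient_def)
  moreover from this have "f z \<noteq> 0"
    by auto
  ultimately show ?thesis
    by (simp add: field_simps)
qed

text \<open>The coefficient form of \<open>(exp w)' = w' exp w\<close>.\<close>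

lemma exp_coeff_recurrence:
  assumes w: "w holomorphic_on unit_disk"
  shows "of_nat (Suc n) * taylor_coeff (\<lambda>z. exp (w z)) (Suc n) =
    (\<Sum>i=0..n. of_nat (Suc i) * taylor_coeff w (Suc i) * taylor_coeff (\<lambda>z. exp (w z)) (n - i))"
proof -
  define E where "E = fps_expansion (\<lambda>z. exp (w z)) 0"
  define W where "W = fps_expansion w 0"
  have exps: "(\<lambda>z. exp (w z)) has_fps_expansion E" "w has_fps_expansion W"
    unfolding E_def W_def using w by (auto intro!: analytic_disk_fps holomorphic_intros)
  have "deriv (\<lambda>z. exp (w z)) z = deriv w z * exp (w z)" if "z \<in> unit_disk" for z
    by (rule DERIV_imp_deriv)
       (use holomorphic_derivI[OF w _ that] in \<open>auto intro!: derivative_eq_intros\<close>)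
  then have "fps_deriv E = fps_deriv W * E"
    by (intro fps_eq_if_eq_on_disk[of "deriv (\<lambda>z. exp (w z))" _ "\<lambda>z. deriv w z * exp (w z)"])
       (intro fps_expansion_intros exps | simp)+
  then have "fps_nth (fps_deriv E) n = fps_nth (fps_deriv W * E) n"
    by simp
  then show ?thesis
    by (simp add: fps_mult_nth E_def W_def taylor_coeff_def)
qed

lemma starlike_coeff_recurrence:
  assumes f: "f holomorphic_on unit_disk" and e: "e holomorphic_on unit_disk"
    and rel: "\<And>z. z \<in> unit_disk \<Longrightarrow> z * deriv f z = e z * f z"
  shows "of_nat n * taylor_coeff f n = (\<Sum>i=0..n. taylor_coeff e i * taylor_coeff f (n - i))"
proof -
  define F where "F = fps_expansion f 0"
  define E where "E = fps_expansion e 0"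
  have exps: "f has_fps_expansion F" "e has_fps_expansion E"
    unfolding F_def E_def using f e by (auto intro: analytic_disk_fps)
  have "fps_X * fps_deriv F = E * F"
    by (rule fps_eq_if_eq_on_disk[of "\<lambda>z. z * deriv f z" _ "\<lambda>z. e z * f z"])
       (intro fps_expansion_intros exps rel | assumption)+
  then have "fps_nth (fps_X * fps_deriv F) n = fps_nth (E * F) n"
    by simp
  moreover have "fps_nth (fps_X * fps_deriv F) n = of_nat n * fps_nth F n"
    by (cases n) simp_all
  ultimately show ?thesis
    by (simp add: fps_mult_nth E_def F_def taylor_coeff_def)
qed

text \<open>The number \<open>5184 = 2\<^sup>6 3\<^sup>4\<close> is the common denominator of the coefficients. The term \<open>A\<^sup>3\<close>
  cancels, which is why no power of \<open>A\<close> alone competes with \<open>B\<^sup>2\<close>.\<close>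

lemma hankel_starlike_exp:
  assumes f: "f \<in> class_A" and w: "schwarz_function w"
    and q: "\<forall>z\<in>unit_disk. starlike_quotient f z = exp (w z)"
    and c: "p = taylor_coeff w 1" "A = taylor_coeff w 2" "B = taylor_coeff w 3" "D = taylor_coeff w 4"
  shows "5184 * hankel_det (taylor_coeff f) 3 1 =
    648 * A * D - 324 * p\<^sup>2 * D - 576 * B\<^sup>2 + 360 * p * A * B - 360 * p\<^sup>2 * A\<^sup>2
    + 204 * p ^ 3 * B + 78 * p ^ 4 * A - 13 * p ^ 6"
proof -
  have hw: "w holomorphic_on unit_disk" and w0: "w 0 = 0"
    using w by (auto simp: schwarz_function_def)
  have hf: "f holomorphic_on unit_disk" and a0: "taylor_coeff f 0 = 0" and a1: "taylor_coeff f 1 = 1"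
    using f by (auto simp: class_A_def)
  define e where "e = (\<lambda>z. exp (w z))"
  have he: "e holomorphic_on unit_disk"
    unfolding e_def using hw by (intro holomorphic_intros)
  note erec = exp_coeff_recurrence[OF hw, folded e_def]
  have frec: "of_nat n * taylor_coeff f n = (\<Sum>i=0..n. taylor_coeff e i * taylor_coeff f (n - i))" for n
    by (rule starlike_coeff_recurrence[OF hf he])
       (use starlike_exp_relation[OF f, of w] q in \<open>auto simp: e_def\<close>)
  define a2 a3 a4 a5 where "a2 = taylor_coeff f 2" and "a3 = taylor_coeff f 3"
    and "a4 = taylor_coeff f 4" and "a5 = taylor_coeff f 5"
  define e1 e2 e3 e4 where "e1 = taylor_coeff e 1" and "e2 = taylor_coeff e 2"
    and "e3 = taylor_coeff e 3" and "e4 = taylor_coeff e 4"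
  have e0: "taylor_coeff e 0 = 1"
    by (simp add: taylor_coeff_0 e_def w0)
  note names = a0 a1[simplified] e0 c a2_def a3_def a4_def a5_def e1_def e2_def e3_def e4_def
    numeral_2_eq_2 numeral_3_eq_3 eval_nat_numeral
  have E: "e1 = p" "2 * e2 = p * e1 + 2 * A" "3 * e3 = p * e2 + 2 * A * e1 + 3 * B"
    "4 * e4 = p * e3 + 2 * A * e2 + 3 * B * e1 + 4 * D"
    using erec[of 0] erec[of 1] erec[of 2] erec[of 3]
    by (simp_all add: names)
  have F: "2 * a2 = a2 + e1" "3 * a3 = a3 + e1 * a2 + e2" "4 * a4 = a4 + e1 * a3 + e2 * a2 + e3"
    "5 * a5 = a5 + e1 * a4 + e2 * a3 + e3 * a2 + e4"
    using frec[of 2] frec[of 3] frec[of 4] frec[of 5]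
    by (simp_all add: names)
  have quot: "a = b / d" if "d * a = b" "d \<noteq> 0" for a b d :: complex
    using that by auto
  have quot': "a = b / d" if "(d + 1) * a = a + b" "d \<noteq> 0" for a b d :: complex
    using that by (auto simp: algebra_simps)
  \<comment> \<open>In the \<open>n\<close>-th recurrence \<open>a\<^sub>n\<close> also occurs on the right-hand side, since \<open>e\<^sub>0 = 1\<close>; what is left is \<open>(n - 1) a\<^sub>n\<close>.\<close>
  have F': "(2 + 1) * a3 = a3 + (e1 * a2 + e2)"
    "(3 + 1) * a4 = a4 + (e1 * a3 + e2 * a2 + e3)"
    "(4 + 1) * a5 = a5 + (e1 * a4 + e2 * a3 + e3 * a2 + e4)"
    using F(2-4) by (simp_all add: add.assoc)
  note E1 = E(1)
  have E2: "e2 = A + p\<^sup>2 / 2"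
  proof -
    have "e2 = (p * e1 + 2 * A) / 2"
      by (rule quot[OF E(2)]) simp_all
    also have "\<dots> = A + p\<^sup>2 / 2"
      unfolding E1 by (simp add: field_simps eval_nat_numeral)
    finally show ?thesis .
  qed
  have E3: "e3 = B + p * A + p ^ 3 / 6"
  proof -
    have "e3 = (p * e2 + 2 * A * e1 + 3 * B) / 3"
      by (rule quot[OF E(3)]) simp_all
    also have "\<dots> = B + p * A + p ^ 3 / 6"
      unfolding E1 E2 by (simp add: field_simps eval_nat_numeral)
    finally show ?thesis .
  qed
  have E4: "e4 = D + p * B + A\<^sup>2 / 2 + p\<^sup>2 * A / 2 + p ^ 4 / 24"
  proof -
    have "e4 = (p * e3 + 2 * A * e2 + 3 * B * e1 + 4 * D) / 4"
      by (rule quot[OF E(4)]) simp_all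
    also have "\<dots> = D + p * B + A\<^sup>2 / 2 + p\<^sup>2 * A / 2 + p ^ 4 / 24"
      unfolding E1 E2 E3 by (simp add: field_simps eval_nat_numeral)
    finally show ?thesis .
  qed
  have F2: "a2 = p"
    using F(1) E1 by simp
  have F3: "a3 = A / 2 + 3/4 * p\<^sup>2"
  proof -
    have "a3 = (e1 * a2 + e2) / 2"
      by (rule quot'[OF F'(1)]) simp_all
    also have "\<dots> = A / 2 + 3/4 * p\<^sup>2"
      unfolding E1 E2 F2 by (simp add: field_simps eval_nat_numeral)
    finally show ?thesis .
  qed
  have F4: "a4 = B / 3 + 5/6 * p * A + 17/36 * p ^ 3"
  proof -
    have "a4 = (e1 * a3 + e2 * a2 + e3) / 3"
      by (rule quot'[OF F'(2)]) simp_all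
    also have "\<dots> = B / 3 + 5/6 * p * A + 17/36 * p ^ 3"
      unfolding E1 E2 E3 F2 F3 by (simp add: field_simps eval_nat_numeral)
    finally show ?thesis .
  qed
  have F5: "a5 = D / 4 + 7/12 * p * B + A\<^sup>2 / 4 + 5/6 * p\<^sup>2 * A + 19/72 * p ^ 4"
  proof -
    have "a5 = (e1 * a4 + e2 * a3 + e3 * a2 + e4) / 4"
      by (rule quot'[OF F'(3)]) simp_all
    also have "\<dots> = D / 4 + 7/12 * p * B + A\<^sup>2 / 4 + 5/6 * p\<^sup>2 * A + 19/72 * p ^ 4"
      unfolding E1 E2 E3 E4 F2 F3 F4 by (simp add: field_simps eval_nat_numeral)
    finally show ?thesis .
  qed
  have "hankel_det (taylor_coeff f) 3 1 = 2 * a2 * a3 * a4 - a3 ^ 3 - a4 ^ 2 - a2 ^ 2 * a5 + a3 * a5"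
    unfolding a2_def a3_def a4_def a5_def by (rule hankel_det_3_1) (rule a1)
  then have "5184 * hankel_det (taylor_coeff f) 3 1 =
      5184 * (2 * a2 * a3 * a4 - a3 ^ 3 - a4 ^ 2 - a2 ^ 2 * a5 + a3 * a5)"
    by simp
  also have "\<dots> = 648 * A * D - 324 * p\<^sup>2 * D - 576 * B\<^sup>2 + 360 * p * A * B - 360 * p\<^sup>2 * A\<^sup>2
    + 204 * p ^ 3 * B + 78 * p ^ 4 * A - 13 * p ^ 6"
    unfolding F2 F3 F4 F5 by (simp add: field_simps eval_nat_numeral)
  finally show ?thesis .
qed

section \<open>The estimate\<close>

text \<open>Here \<open>T\<close> and \<open>R\<close> stand for \<open>1 - \<bar>p\<bar>\<^sup>2\<close> and \<open>1 - \<bar>x\<bar>\<^sup>2\<close>, and \<open>pc\<close>, \<open>xc\<close> for the conjugates of \<open>p\<close>, \<open>x\<close>. The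
  identity is one between polynomials in all of them as indeterminates. The terms are sorted by
  \<open>v\<close>, \<open>y\<^sup>2\<close> and \<open>y\<close>: since \<open>\<bar>v\<bar> + \<bar>y\<bar>\<^sup>2 \<le> 1\<close>, the contributions of \<open>v\<close> and \<open>y\<^sup>2\<close> cost together no more
  than the larger of their two coefficients.\<close>

lemma hankel_schur_form:
  fixes p pc x xc y v T R :: complex
  defines "\<phi>1 \<equiv> R * y" and "\<phi>2 \<equiv> R * (v - xc * y\<^sup>2)"
  defines "A \<equiv> T * x" and "B \<equiv> T * (\<phi>1 - pc * x\<^sup>2)"
    and "D \<equiv> T * (\<phi>2 - 2 * pc * x * \<phi>1 + pc\<^sup>2 * x ^ 3)"
  shows "648 * A * D - 324 * p\<^sup>2 * D - 576 * B\<^sup>2 + 360 * p * A * B - 360 * p\<^sup>2 * A\<^sup>2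
    + 204 * p ^ 3 * B + 78 * p ^ 4 * A - 13 * p ^ 6 =
    R * T * ((648 * T * x - 324 * p\<^sup>2) * v - (72 * T * (8 * R + 9 * (x * xc)) - 324 * p\<^sup>2 * xc) * y\<^sup>2
       + (p * x * (648 * (p * pc) + 360 * T) - 144 * T * pc * x\<^sup>2 + 204 * p ^ 3) * y)
    + (72 * T\<^sup>2 * pc\<^sup>2 * x ^ 4 - T * (p * pc) * x ^ 3 * (324 * (p * pc) + 360 * T)
       - T * p\<^sup>2 * x\<^sup>2 * (360 * T + 204 * (p * pc)) + 78 * T * p ^ 4 * x - 13 * p ^ 6)"
  unfolding A_def B_def D_def \<phi>1_def \<phi>2_def
  by (simp add: algebra_simps power2_eq_square eval_nat_numeral)

text \<open>The maximum is at \<open>x = 1 / sqrt 3\<close>. With the slightly larger \<open>a = 29/50\<close>, the tangent estimate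
  \<open>0 \<le> (x - a)\<^sup>2 (x + 2 a) = x\<^sup>3 - 3 a\<^sup>2 x + 2 a\<^sup>3\<close> suffices, as \<open>3 a\<^sup>2 \<ge> 1\<close> and \<open>2 a\<^sup>3 \<le> 2/5\<close>.\<close>

lemma times_one_minus_square_le:
  fixes x :: real
  assumes "0 \<le> x"
  shows "x * (1 - x\<^sup>2) \<le> 2/5"
proof -
  have "0 \<le> (x - 29/50)\<^sup>2 * (x + 29/25)"
    using assms by simp
  also have "\<dots> = x ^ 3 - 2523/2500 * x + 24389/62500"
    by (simp add: power2_eq_square power3_eq_cube field_simps)
  finally have "x - x ^ 3 \<le> 2/5"
    using assms by linarith
  then show ?thesis
    by (simp add: power2_eq_square power3_eq_cube algebra_simps)
qed

text \<open>Equality holds at \<open>P = r = 0\<close>. The leading term is at most \<open>576 t\<^sup>2 - 504 t\<^sup>2 r\<^sup>2\<close>, and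
  \<open>576 = 576 t\<^sup>2 + 576 Q (1 + t)\<close>, so there is room for multiples of \<open>t\<^sup>2 r\<^sup>2\<close> and of \<open>Q = P\<^sup>2\<close>. The only
  remaining terms that do not contain \<open>Q\<close> are multiples of \<open>P r\<close>. By the inequality of the means
  they are absorbed by \<open>504 t\<^sup>2 r\<^sup>2\<close> and a small multiple of \<open>Q\<close>. For the terms with a factor \<open>Q\<close> crude
  bounds are then enough; the auxiliary \<open>K\<close> collects those that also contain \<open>t\<close>.\<close>

lemma hankel_real_bound:
  fixes P r :: real
  assumes P: "0 \<le> P" "P \<le> 1" and r: "0 \<le> r" "r \<le> 1"
  defines "Q \<equiv> P\<^sup>2" and "t \<equiv> 1 - P\<^sup>2" and "R \<equiv> 1 - r\<^sup>2"
  shows "R * t * ((72 * t * (8 * R + 9 * r\<^sup>2) + 324 * Q)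
       + (P * r * (648 * Q + 360 * t) + 144 * t * P * r\<^sup>2 + 204 * P ^ 3))
    + (72 * t\<^sup>2 * P\<^sup>2 * r ^ 4 + t * Q * r ^ 3 * (324 * Q + 360 * t)
       + t * P\<^sup>2 * r\<^sup>2 * (360 * t + 204 * Q) + 78 * t * P ^ 4 * r + 13 * P ^ 6) \<le> 576"
proof -
  have Q: "0 \<le> Q" "Q \<le> 1" and t: "0 \<le> t" "t \<le> 1" and Qt: "Q + t = 1"
    and R: "0 \<le> R" "R \<le> 1"
    using P r by (auto simp: Q_def t_def R_def power_le_one)
  have tP: "P * t \<le> 2/5" and rR: "r * R \<le> 2/5"
    unfolding t_def R_def using P r by (auto intro!: times_one_minus_square_le simp del: le_divide_eq_numeral1)

  have "R * (8 * R + 9 * r\<^sup>2) = 8 - 7 * r\<^sup>2 - r ^ 4"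
    by (simp add: R_def algebra_simps power2_eq_square eval_nat_numeral)
  also have "\<dots> \<le> 8 - 7 * r\<^sup>2"
    using r by simp
  finally have main: "t\<^sup>2 * (R * (8 * R + 9 * r\<^sup>2)) \<le> t\<^sup>2 * (8 - 7 * r\<^sup>2)"
    by (rule mult_left_mono) simp

  have "R * (360 + 144 * r) \<le> 1 * 504"
    using R r by (intro mult_mono) auto
  then have "P * r * (R * (360 + 144 * r)) \<le> P * r * 504"
    using P r by (intro mult_left_mono) auto
  also have "\<dots> \<le> 504 * (r\<^sup>2 + 1/4 * Q)"
    using zero_le_power2[of "r - P / 2"]
    by (simp add: Q_def power2_eq_square algebra_simps)
  finally have cross: "t\<^sup>2 * (P * r * (R * (360 + 144 * r))) \<le> t\<^sup>2 * (504 * (r\<^sup>2 + 1/4 * Q))"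
    by (rule mult_left_mono) simp

  \<comment> \<open>Since \<open>R + r\<^sup>2 = 1\<close>, bounding the cofactors of \<open>R\<close> and \<open>r\<^sup>2\<close> both by \<open>792\<close> bounds the sum by \<open>792\<close>.\<close>
  define K where "K = R * (324 + 204 * P) + 648 * P * (r * R)
    + r\<^sup>2 * (72 * t * r\<^sup>2 + r * (324 * Q + 360 * t) + (360 * t + 204 * Q)) + 78 * (Q * r)"
  have "R * (324 + 204 * P) \<le> R * (792)"
    using R P by (intro mult_left_mono) auto
  moreover have "648 * P * (r * R) \<le> 648 * P * (2/5)"
    using rR P by (intro mult_left_mono) auto
  moreover have "r\<^sup>2 * (72 * t * r\<^sup>2 + r * (324 * Q + 360 * t) + (360 * t + 204 * Q)) \<le> r\<^sup>2 * (792)"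
  proof (rule mult_left_mono)
    have "72 * t * r\<^sup>2 \<le> 72 * t * 1"
      using t r by (intro mult_left_mono) (auto simp: power_le_one)
    moreover have "r * (324 * Q + 360 * t) \<le> 1 * (324 * Q + 360 * t)"
      using t Q r by (intro mult_right_mono) auto
    ultimately have "72 * t * r\<^sup>2 + r * (324 * Q + 360 * t) + (360 * t + 204 * Q)
        \<le> 72 * t * 1 + 1 * (324 * Q + 360 * t) + (360 * t + 204 * Q)"
      by (intro add_mono order_refl)
    also have "\<dots> = 792 * (Q + t) - 264 * Q"
      by (simp add: algebra_simps)
    also have "\<dots> \<le> 792"
      using Q by (simp add: Qt)
    finally show "72 * t * r\<^sup>2 + r * (324 * Q + 360 * t) + (360 * t + 204 * Q) \<le> 792" .
  qed simp
  moreover have "Q * r \<le> 1 * 1"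
    using Q r by (intro mult_mono) auto
  moreover have "R * (792) + r\<^sup>2 * (792) = 792"
    by (simp add: R_def algebra_simps)
  ultimately have K: "K \<le> 870 + 1296/5 * P"
    unfolding K_def by linarith

  have "126 * t\<^sup>2 + t * K + 13 * Q\<^sup>2 \<le> 576 * (1 + t)"
  proof -
    have "t * K \<le> t * (870 + 1296/5 * P)"
      using K t by (intro mult_left_mono) auto
    also have "\<dots> = 870 * t + 1296/5 * (P * t)"
      by (simp add: algebra_simps)
    finally have "t * K \<le> 870 * t + 1296/5 * (2/5)"
      using tP by linarith
    moreover have "t\<^sup>2 \<le> t"
      using t by (simp add: power2_eq_square mult_left_le)
    moreover have "Q\<^sup>2 \<le> 1"
      using Q by (rule power_le_one)
    ultimately show ?thesis
      using t by argo
  qed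
  then have rest: "Q * (126 * t\<^sup>2 + t * K + 13 * Q\<^sup>2) \<le> Q * (576 * (1 + t))"
    using Q by (intro mult_left_mono) auto

  have P46: "P ^ 3 = Q * P" "P ^ 4 = Q\<^sup>2" "P ^ 6 = Q ^ 3"
    by (simp_all add: Q_def eval_nat_numeral)
  have "R * t * ((72 * t * (8 * R + 9 * r\<^sup>2) + 324 * Q)
       + (P * r * (648 * Q + 360 * t) + 144 * t * P * r\<^sup>2 + 204 * P ^ 3))
    + (72 * t\<^sup>2 * P\<^sup>2 * r ^ 4 + t * Q * r ^ 3 * (324 * Q + 360 * t)
       + t * P\<^sup>2 * r\<^sup>2 * (360 * t + 204 * Q) + 78 * t * P ^ 4 * r + 13 * P ^ 6)
    = 72 * (t\<^sup>2 * (R * (8 * R + 9 * r\<^sup>2))) + t\<^sup>2 * (P * r * (R * (360 + 144 * r)))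
      + Q * (t * K + 13 * Q\<^sup>2)"
    unfolding K_def P46 Q_def[symmetric]
    by (simp add: algebra_simps add_divide_distrib diff_divide_distrib power2_eq_square eval_nat_numeral)
  also have "\<dots> \<le> 72 * (t\<^sup>2 * (8 - 7 * r\<^sup>2)) + t\<^sup>2 * (504 * (r\<^sup>2 + 1/4 * Q))
      + Q * (t * K + 13 * Q\<^sup>2)"
    using main cross by linarith
  also have "\<dots> = 576 * t\<^sup>2 + Q * (126 * t\<^sup>2 + t * K + 13 * Q\<^sup>2)"
    by (simp add: algebra_simps)
  also have "\<dots> \<le> 576 * t\<^sup>2 + Q * (576 * (1 + t))"
    using rest by simp
  also have "\<dots> = 576"
    by (simp add: Q_def t_def algebra_simps power2_eq_square)
  finally show ?thesis .
qed

text \<open>The triangle inequality, applied to the grouping of lemma \<open>hankel_schur_form\<close>. The coefficients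
  \<open>\<alpha>\<close> of \<open>v\<close> and \<open>\<beta>\<close> of \<open>y\<^sup>2\<close> have the common bound \<open>\<kappa>\<close>: for \<open>\<alpha>\<close> this is \<open>9 r \<le> 8 + r\<^sup>2\<close>, that is
  \<open>(1 - r) (8 - r) \<ge> 0\<close>. Hence \<open>y\<close> and \<open>v\<close> disappear from the bound.\<close>

lemma hankel_schur_bound:
  fixes p x y v :: complex
  assumes p: "norm p \<le> 1" and x: "norm x \<le> 1" and y: "norm y \<le> 1" and v: "norm v \<le> 1 - (norm y)\<^sup>2"
  defines "T \<equiv> 1 - p * cnj p" and "R \<equiv> 1 - x * cnj x"
  shows "norm (R * T * ((648 * T * x - 324 * p\<^sup>2) * v - (72 * T * (8 * R + 9 * (x * cnj x)) - 324 * p\<^sup>2 * cnj x) * y\<^sup>2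
       + (p * x * (648 * (p * cnj p) + 360 * T) - 144 * T * cnj p * x\<^sup>2 + 204 * p ^ 3) * y)
    + (72 * T\<^sup>2 * (cnj p)\<^sup>2 * x ^ 4 - T * (p * cnj p) * x ^ 3 * (324 * (p * cnj p) + 360 * T)
       - T * p\<^sup>2 * x\<^sup>2 * (360 * T + 204 * (p * cnj p)) + 78 * T * p ^ 4 * x - 13 * p ^ 6)) \<le> 576"
    (is "norm (R * T * (?\<alpha> * v - ?\<beta> * y\<^sup>2 + ?\<gamma> * y) + ?\<delta>) \<le> 576")
proof -
  define P r s Q t \<rho> where "P = norm p" and "r = norm x" and "s = norm y"
    and "Q = P\<^sup>2" and "t = 1 - P\<^sup>2" and "\<rho> = 1 - r\<^sup>2"
  have bnds: "0 \<le> P" "P \<le> 1" "0 \<le> r" "r \<le> 1" "0 \<le> s" "s \<le> 1" "0 \<le> Q" "0 \<le> t" "0 \<le> \<rho>" "s\<^sup>2 \<le> 1"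
    using p x y by (auto simp: P_def r_def s_def Q_def t_def \<rho>_def power_le_one)
  have pp: "p * cnj p = of_real Q" and xx: "x * cnj x = of_real (r\<^sup>2)"
    by (simp_all only: P_def Q_def r_def complex_norm_square)
  have T: "T = of_real t" and R: "R = of_real \<rho>"
    unfolding T_def R_def pp xx by (simp_all add: t_def Q_def \<rho>_def)
  have nrm: "norm (of_real a * z) = a * norm z" if "0 \<le> a" for a and z :: complex
    using that by (simp add: norm_mult)
  define \<kappa> where "\<kappa> = 72 * t * (8 * \<rho> + 9 * r\<^sup>2) + 324 * Q"
  have "norm ?\<alpha> \<le> norm (648 * T * x) + norm (324 * p\<^sup>2)"
    by (rule norm_triangle_ineq4)
  also have "\<dots> = 72 * t * (9 * r) + 324 * Q"
    using bnds by (simp add: T norm_mult norm_power P_def r_def Q_def)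
  also have "\<dots> \<le> \<kappa>"
  proof -
    have "0 \<le> (1 - r) * (8 - r)"
      using bnds by simp
    then have "9 * r \<le> 8 * \<rho> + 9 * r\<^sup>2"
      by (simp add: \<rho>_def power2_eq_square algebra_simps)
    then have "72 * t * (9 * r) \<le> 72 * t * (8 * \<rho> + 9 * r\<^sup>2)"
      using bnds by (intro mult_left_mono) auto
    then show ?thesis
      unfolding \<kappa>_def by simp
  qed
  finally have \<alpha>: "norm ?\<alpha> \<le> \<kappa>" .
  have "72 * T * (8 * R + 9 * (x * cnj x)) = of_real (72 * t * (8 * \<rho> + 9 * r\<^sup>2))"
    unfolding T R xx by simp
  moreover have "0 \<le> 72 * t * (8 * \<rho> + 9 * r\<^sup>2)"
    using bnds by simp
  ultimately have \<beta>1: "norm (72 * T * (8 * R + 9 * (x * cnj x))) = 72 * t * (8 * \<rho> + 9 * r\<^sup>2)"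
    by (simp only: norm_of_real abs_of_nonneg)
  have \<beta>2: "norm (324 * p\<^sup>2 * cnj x) = 324 * Q * r"
    by (simp add: norm_mult norm_power P_def r_def Q_def)
  have "norm ?\<beta> \<le> 72 * t * (8 * \<rho> + 9 * r\<^sup>2) + 324 * Q * r"
    by (rule order_trans[OF norm_triangle_ineq4]) (simp only: \<beta>1 \<beta>2 order_refl)
  also have "\<dots> \<le> \<kappa>"
    unfolding \<kappa>_def using bnds by (simp add: mult_left_le)
  finally have \<beta>: "norm ?\<beta> \<le> \<kappa>" .
  have norm_combination: "norm (a * (p * cnj p) + b * T) = a' * Q + b' * t"
    if "a = of_real a'" "b = of_real b'" "0 \<le> a'" "0 \<le> b'" for a b a' b'
  proof -
    have "a * (p * cnj p) + b * T = of_real (a' * Q + b' * t)"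
      unfolding T pp that by simp
    moreover have "0 \<le> a' * Q + b' * t"
      using bnds that by simp
    ultimately show ?thesis
      by (simp only: norm_of_real abs_of_nonneg)
  qed
  have norm_T: "norm T = t" and norm_pp: "norm (p * cnj p) = Q"
    unfolding T pp using bnds by simp_all
  have \<gamma>1: "norm (p * x * (648 * (p * cnj p) + 360 * T)) = P * r * (648 * Q + 360 * t)"
    unfolding norm_mult[of "p * x"] by (subst norm_combination[of _ 648 _ 360]) (simp_all add: norm_mult P_def r_def)
  have \<gamma>2: "norm (144 * T * cnj p * x\<^sup>2) = 144 * t * P * r\<^sup>2"
    by (simp add: norm_T norm_mult norm_power P_def r_def)
  have \<gamma>3: "norm (204 * p ^ 3) = 204 * P ^ 3"
    by (simp add: norm_mult norm_power P_def)
  have triangle3: "norm (a - b + c) \<le> norm a + norm b + norm c" for a b c :: complex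
    by (rule order_trans[OF norm_triangle_ineq]) (simp add: norm_triangle_ineq4)
  have \<gamma>: "norm ?\<gamma> \<le> P * r * (648 * Q + 360 * t) + 144 * t * P * r\<^sup>2 + 204 * P ^ 3"
    (is "_ \<le> ?g")
    by (rule order_trans[OF triangle3]) (simp only: \<gamma>1 \<gamma>2 \<gamma>3 order_refl)
  have \<delta>1: "norm (72 * T\<^sup>2 * (cnj p)\<^sup>2 * x ^ 4) = 72 * t\<^sup>2 * P\<^sup>2 * r ^ 4"
    by (simp add: norm_T norm_mult norm_power P_def r_def)
  have \<delta>2: "norm (T * (p * cnj p) * x ^ 3 * (324 * (p * cnj p) + 360 * T)) =
      t * Q * r ^ 3 * (324 * Q + 360 * t)"
    unfolding norm_mult[of _ "324 * (p * cnj p) + 360 * T"] norm_mult[of _ "x ^ 3"] norm_mult[of T] norm_pp norm_T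
    by (subst norm_combination[of _ 324 _ 360]) (simp_all add: norm_power r_def)
  have \<delta>3: "norm (T * p\<^sup>2 * x\<^sup>2 * (360 * T + 204 * (p * cnj p))) = t * P\<^sup>2 * r\<^sup>2 * (360 * t + 204 * Q)"
    unfolding add.commute[of "360 * T"] norm_mult[of _ "204 * (p * cnj p) + 360 * T"]
    by (subst norm_combination[of _ 204 _ 360]) (simp_all add: norm_T norm_mult norm_power P_def r_def)
  have \<delta>4: "norm (78 * T * p ^ 4 * x) = 78 * t * P ^ 4 * r"
    by (simp add: norm_T norm_mult norm_power P_def r_def)
  have \<delta>5: "norm (13 * p ^ 6) = 13 * P ^ 6"
    by (simp add: norm_mult norm_power P_def)
  have triangle5: "norm (a - b - c + d - e) \<le> norm a + norm b + norm c + norm d + norm e"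
    for a b c d e :: complex
    by (smt (verit) norm_triangle_ineq norm_triangle_ineq4)
  have \<delta>: "norm ?\<delta> \<le> 72 * t\<^sup>2 * P\<^sup>2 * r ^ 4 + t * Q * r ^ 3 * (324 * Q + 360 * t)
      + t * P\<^sup>2 * r\<^sup>2 * (360 * t + 204 * Q) + 78 * t * P ^ 4 * r + 13 * P ^ 6"
    (is "_ \<le> ?d")
    by (rule order_trans[OF triangle5]) (simp only: \<delta>1 \<delta>2 \<delta>3 \<delta>4 \<delta>5 order_refl)
  have "norm (?\<alpha> * v - ?\<beta> * y\<^sup>2 + ?\<gamma> * y) \<le> norm (?\<alpha> * v) + norm (?\<beta> * y\<^sup>2) + norm (?\<gamma> * y)"
    by (rule triangle3)
  also have "\<dots> \<le> \<kappa> * (1 - s\<^sup>2) + \<kappa> * s\<^sup>2 + ?g * 1"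
    unfolding norm_mult norm_power s_def[symmetric]
    using \<alpha> \<beta> \<gamma> v bnds order_trans[OF norm_ge_zero \<alpha>] order_trans[OF norm_ge_zero \<gamma>]
    by (intro add_mono mult_mono) (auto simp: s_def)
  also have "\<dots> = \<kappa> + ?g"
    by (simp add: algebra_simps)
  finally have inner: "norm (?\<alpha> * v - ?\<beta> * y\<^sup>2 + ?\<gamma> * y) \<le> \<kappa> + ?g" .
  have "norm (R * T * (?\<alpha> * v - ?\<beta> * y\<^sup>2 + ?\<gamma> * y) + ?\<delta>)
      \<le> norm (R * T * (?\<alpha> * v - ?\<beta> * y\<^sup>2 + ?\<gamma> * y)) + norm ?\<delta>"
    by (rule norm_triangle_ineq)
  also have "norm (R * T * (?\<alpha> * v - ?\<beta> * y\<^sup>2 + ?\<gamma> * y)) = \<rho> * t * norm (?\<alpha> * v - ?\<beta> * y\<^sup>2 + ?\<gamma> * y)"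
    using bnds nrm[of "\<rho> * t"] by (simp only: R T of_real_mult [symmetric]) simp
  also have "\<dots> + norm ?\<delta> \<le> \<rho> * t * (\<kappa> + ?g) + ?d"
    using inner \<delta> bnds by (intro add_mono mult_left_mono) auto
  also have "\<dots> \<le> 576"
    using hankel_real_bound[OF bnds(1-4)] unfolding \<kappa>_def Q_def t_def \<rho>_def .
  finally show ?thesis .
qed

lemma starlike_exp_hankel_bound:
  assumes "f \<in> class_S_star_e"
  shows "norm (hankel_det (taylor_coeff f) 3 1) \<le> 1/9"
proof -
  obtain w where f: "f \<in> class_A" and w: "schwarz_function w"
    and q: "\<forall>z\<in>unit_disk. starlike_quotient f z = exp (w z)"
    using assms by (auto simp: class_S_star_e_def subordinate_def)
  obtain g where g: "schur_function g" and wg: "\<And>z. z \<in> unit_disk \<Longrightarrow> w z = z * g z"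
    using schwarz_function_factor[OF w] by blast
  have "fps_expansion w 0 = fps_X * fps_expansion g 0"
    by (rule fps_eq_if_eq_on_disk[of w _ "\<lambda>z. z * g z"])
       (use w g wg in \<open>auto simp: schwarz_function_def schur_function_def
          intro!: fps_expansion_intros analytic_disk_fps\<close>)
  then have shift: "taylor_coeff w (Suc n) = taylor_coeff g n" for n
    by (simp add: taylor_coeff_def)
  define p where "p = taylor_coeff g 0"
  have p: "norm p \<le> 1"
    using g by (simp add: p_def taylor_coeff_0 schur_function_def)
  obtain x y v \<phi>1 \<phi>2 where xyv: "norm x \<le> 1" "norm y \<le> 1" "norm v \<le> 1 - (norm y)\<^sup>2"
    and \<phi>: "\<phi>1 = (1 - x * cnj x) * y" "\<phi>2 = (1 - x * cnj x) * (v - cnj x * y\<^sup>2)"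
    and c: "taylor_coeff g 1 = (1 - p * cnj p) * x"
      "taylor_coeff g 2 = (1 - p * cnj p) * (\<phi>1 - cnj p * x\<^sup>2)"
      "taylor_coeff g 3 = (1 - p * cnj p) * (\<phi>2 - 2 * cnj p * x * \<phi>1 + (cnj p)\<^sup>2 * x ^ 3)"
    using schur_parameters[OF g p_def] by blast
  have w1: "p = taylor_coeff w 1"
    using shift[of 0] by (simp add: p_def)
  have w2: "(1 - p * cnj p) * x = taylor_coeff w 2"
    using shift[of 1] c(1) by (simp add: numeral_2_eq_2)
  have w3: "(1 - p * cnj p) * ((1 - x * cnj x) * y - cnj p * x\<^sup>2) = taylor_coeff w 3"
    using shift[of 2] c(2) by (simp add: \<phi>)
  have w4: "(1 - p * cnj p) * ((1 - x * cnj x) * (v - cnj x * y\<^sup>2)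
      - 2 * cnj p * x * ((1 - x * cnj x) * y) + (cnj p)\<^sup>2 * x ^ 3) = taylor_coeff w 4"
    using shift[of 3] c(3) by (simp add: \<phi>)
  have "norm (5184 * hankel_det (taylor_coeff f) 3 1) \<le> 576"
    unfolding trans[OF hankel_starlike_exp[OF f w q w1 w2 w3 w4] hankel_schur_form]
    by (rule hankel_schur_bound[OF p xyv])
  then show ?thesis
    by (simp add: norm_mult)
qed

section \<open>The extremal function\<close>

text \<open>The equation \<open>z f'/f = exp w\<close> is solved by \<open>f(z) = z exp(k(z))\<close>, where \<open>k\<close> is the primitive of the
  function \<open>(exp(w(z)) - 1)/z\<close> with \<open>k(0) = 0\<close>.\<close>

lemma starlike_exp_exists:
  assumes w: "schwarz_function w"
  obtains f where "f \<in> class_S_star_e" "\<And>z. z \<in> unit_disk \<Longrightarrow> starlike_quotient f z = exp (w z)"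
proof -
  have hw: "w holomorphic_on unit_disk" and w0: "w 0 = 0"
    using w by (auto simp: schwarz_function_def)
  have he: "(\<lambda>z. exp (w z) - 1) holomorphic_on ball 0 1" and e0: "exp (w 0) - 1 = 0"
    using hw w0 by (auto intro!: holomorphic_intros)
  obtain h where h: "h holomorphic_on unit_disk"
    and hz: "\<And>z. norm z < 1 \<Longrightarrow> exp (w z) - 1 = z * h z"
    using Schwarz3[OF he e0] by blast
  have "\<exists>k. \<forall>z\<in>unit_disk. (k has_field_derivative h z) (at z within unit_disk)"
  proof (rule holomorphic_convex_primitive'[OF convex_ball open_ball h])
    fix k assume "\<And>z. z \<in> unit_disk \<Longrightarrow> (k has_field_derivative h z) (at z within unit_disk)"
    then have "\<forall>z\<in>unit_disk. (k has_field_derivative h z) (at z within unit_disk)"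
      by (rule ballI)
    then show ?thesis
      by (rule exI[of _ k])
  qed
  then obtain k where
    k: "\<forall>z\<in>unit_disk. (k has_field_derivative h z) (at z within unit_disk)"
    by blast
  define f where "f = (\<lambda>z. z * exp (k z - k 0))"
  have f': "(f has_field_derivative exp (w z) * exp (k z - k 0)) (at z)" if z: "z \<in> unit_disk" for z
  proof -
    have kz: "(k has_field_derivative h z) (at z)"
      using k z at_within_open[OF z open_ball] by metis
    have e: "((\<lambda>z. exp (k z - k 0)) has_field_derivative exp (k z - k 0) * h z) (at z)"
      using kz by (auto intro!: derivative_eq_intros)
    have "(f has_field_derivative 1 * exp (k z - k 0) + exp (k z - k 0) * h z * z) (at z)"
      unfolding f_def by (rule DERIV_mult[OF DERIV_ident e])
    also have "1 * exp (k z - k 0) + exp (k z - k 0) * h z * z = (1 + z * h z) * exp (k z - k 0)"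
      by (simp add: algebra_simps)
    also have "1 + z * h z = exp (w z)"
      using hz[of z] z by (simp add: algebra_simps)
    finally show ?thesis .
  qed
  have hf: "f holomorphic_on unit_disk"
    unfolding holomorphic_on_def field_differentiable_def
    using has_field_derivative_at_within[OF f'] by blast
  have df: "deriv f z = exp (w z) * exp (k z - k 0)" if "z \<in> unit_disk" for z
    using f'[OF that] by (rule DERIV_imp_deriv)
  have "f 0 = 0" "deriv f 0 = 1"
    using df[of 0] w0 by (simp_all add: f_def)
  then have fA: "f \<in> class_A"
    unfolding class_A_def taylor_coeff_def fps_expansion_def using hf by simp
  have q: "starlike_quotient f z = exp (w z)" if z: "z \<in> unit_disk" for z
  proof (cases "z = 0")
    case True
    then show ?thesis
      by (simp add: starlike_quotient_def w0)
  next
    case False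
    have "z * (exp (w z) * exp (k z - k 0)) / (z * exp (k z - k 0)) = exp (w z)"
      using False by (simp add: divide_simps)
    moreover have "f z = z * exp (k z - k 0)"
      by (simp add: f_def)
    ultimately show ?thesis
      using False by (simp only: starlike_quotient_def df[OF z] if_False)
  qed
  have "(\<lambda>z. exp (w z)) holomorphic_on unit_disk"
    using hw by (intro holomorphic_intros)
  then have hq: "starlike_quotient f holomorphic_on unit_disk"
    by (rule holomorphic_transform) (simp only: q)
  have "subordinate (starlike_quotient f) exp"
    unfolding subordinate_def using hq w q holomorphic_on_exp by blast
  then have "f \<in> class_S_star_e"
    using fA by (simp add: class_S_star_e_def)
  then show thesis
    using q by (rule that)
qed

lemma starlike_exp_hankel_sharp:
  obtains f where "f \<in> class_S_star_e" "hankel_det (taylor_coeff f) 3 1 = - 1/9"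
proof -
  define w :: "complex \<Rightarrow> complex" where "w = (\<lambda>z. z ^ 3)"
  have "norm z ^ 3 \<le> norm z" if "norm z < 1" for z :: complex
    using power_decreasing[of 1 3 "norm z"] that by simp
  then have w: "schwarz_function w"
    by (auto simp: schwarz_function_def w_def norm_power intro!: holomorphic_intros)
  obtain f where f: "f \<in> class_S_star_e" "\<And>z. z \<in> unit_disk \<Longrightarrow> starlike_quotient f z = exp (w z)"
    using starlike_exp_exists[OF w] by blast
  have "w has_fps_expansion fps_X ^ 3"
    unfolding w_def by (intro fps_expansion_intros)
  then have "fps_expansion w 0 = fps_X ^ 3"
    using fps_expansion_eqI by blast
  then have coeff: "taylor_coeff w n = (if n = 3 then 1 else 0)" for n
    by (simp add: taylor_coeff_def)
  have "f \<in> class_A"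
    using f(1) by (simp add: class_S_star_e_def)
  moreover have "\<forall>z\<in>unit_disk. starlike_quotient f z = exp (w z)"
    using f(2) by blast
  ultimately have "5184 * hankel_det (taylor_coeff f) 3 1 = - 576"
    by (subst hankel_starlike_exp[OF _ w _ refl refl refl refl]) (simp_all add: coeff)
  then have "hankel_det (taylor_coeff f) 3 1 = - 1/9"
    by (simp add: field_simps)
  with f(1) show thesis
    by (rule that)
qed

theorem theorem2p2:
  shows "(\<forall>f \<in> class_S_star_e.
            let a = taylor_coeff f; H = hankel_det a 3 1 in
              H = 2 * a 2 * a 3 * a 4 - (a 3)^3 - (a 4)^2 - (a 2)^2 * a 5 + a 3 * a 5 \<and>
              norm H \<le> 1 / 9) \<and>
         (\<exists>f \<in> class_S_star_e. norm (hankel_det (taylor_coeff f) 3 1) = 1 / 9)"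
proof (intro conjI ballI)
  fix f assume f: "f \<in> class_S_star_e"
  then have "taylor_coeff f 1 = 1"
    by (simp add: class_S_star_e_def class_A_def)
  then show "let a = taylor_coeff f; H = hankel_det a 3 1 in
      H = 2 * a 2 * a 3 * a 4 - (a 3)^3 - (a 4)^2 - (a 2)^2 * a 5 + a 3 * a 5 \<and> norm H \<le> 1 / 9"
    using starlike_exp_hankel_bound[OF f] hankel_det_3_1[of "taylor_coeff f"] by (simp add: Let_def)
next
  obtain f where "f \<in> class_S_star_e" "hankel_det (taylor_coeff f) 3 1 = - 1/9"
    by (rule starlike_exp_hankel_sharp)
  then show "\<exists>f\<in>class_S_star_e. norm (hankel_det (taylor_coeff f) 3 1) = 1 / 9"
    by (intro bexI[of _ f]) (simp_all add: norm_divide)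
qed

end
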